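(* Let $V$ be a vector space over $\Bbbk$ with fixed ordered basis $\{x_1,\ldots,x_n\}$, let $\mu\in M(n,\Bbbk)$ be multiplicatively antisymmetric, and let $\phi:V\times V\to\Bbbk$ be a $\mu$-symmetric bilinear form relative to this basis. Let $g:V\to\mathrm{sCl}(V,\mu,\phi)$ be the canonical linear map. If $g$ is injective, then $\mathrm{sCl}(V,\mu,\phi)$ satisfies $$g(x_i)g(x_j)+\mu_{ij}g(x_j)g(x_i)=2\phi(x_i,x_j)\cdot 1$$ for all $i,j\in\{1,\ldots,n\}$, and, for every $\Bbbk$-algebra $A$ and every injective linear map $f:V\to A$ with $$f(x_i)f(x_j)+\mu_{ij}f(x_j)f(x_i)=2\phi(x_i,x_j)\cdot 1_A$$ for all $i,j\in\{1,\ldots,n\}$, there is a unique algebra homomorphism $\bar f:\mathrm{sCl}(V,\mu,\phi)\to A$ such that $f=\bar f\circ g$.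
   Context: $\Bbbk$ is a field with $\mathrm{char}(\Bbbk)\neq 2$; algebras are associative and unital. A matrix $\mu=(\mu_{ij})\in M(n,\Bbbk)$ is multiplicatively antisymmetric if $\mu_{ij}\mu_{ji}=\mu_{ii}=1$ for all $i,j$. A bilinear form $\phi$ is $\mu$-symmetric (relative to $\{x_1,\ldots,x_n\}$) if $\phi(x_i,x_j)=\mu_{ij}\phi(x_j,x_i)$ for all $i,j$. The skew Clifford algebra $\mathrm{sCl}(V,\mu,\phi)$ is the quotient of the tensor algebra $T(V)$ by the two-sided ideal generated by all elements $x_i\otimes x_j+\mu_{ij}\,x_j\otimes x_i-2\phi(x_i,x_j)\cdot 1$, for all $i,j$. The map $g:V\to\mathrm{sCl}(V,\mu,\phi)$ is the inclusion $V\hookrightarrow T(V)$ followed by the natural projection $T(V)\to\mathrm{sCl}(V,\mu,\phi)$. *)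

theory Defs
  imports "Jordan_Normal_Form.Missing_VectorSpace" "HOL-Algebra.QuotRing"
begin

section \<open>Associative unital algebras over a field\<close>

text \<open>The library's locale \<^locale>\<open>algebra\<close> requires a commutative product, so it cannot be used here.\<close>

locale assoc_algebra = vectorspace K A + A?: ring A for K (structure) and A (structure) +
  assumes smult_mult_left: "\<lbrakk>c \<in> carrier K; a \<in> carrier A; b \<in> carrier A\<rbrakk> \<Longrightarrow>
      (c \<odot>\<^bsub>A\<^esub> a) \<otimes>\<^bsub>A\<^esub> b = c \<odot>\<^bsub>A\<^esub> (a \<otimes>\<^bsub>A\<^esub> b)"
    and smult_mult_right: "\<lbrakk>c \<in> carrier K; a \<in> carrier A; b \<in> carrier A\<rbrakk> \<Longrightarrow>
      a \<otimes>\<^bsub>A\<^esub> (c \<odot>\<^bsub>A\<^esub> b) = c \<odot>\<^bsub>A\<^esub> (a \<otimes>\<^bsub>A\<^esub> b)"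

definition algebra_hom ::
    "('k, 'm) ring_scheme \<Rightarrow> ('k, 'a, 'p) module_scheme \<Rightarrow> ('k, 'b, 'q) module_scheme \<Rightarrow> ('a \<Rightarrow> 'b) set"
  where "algebra_hom K A B = ring_hom A B \<inter> module_hom K A B"

text \<open>The quotient ring \<open>A Quot I\<close> with the induced scalar multiplication
  \<open>c (I + a) = I + c a\<close>, written as a union over representatives in the same way as
  \<^const>\<open>rcoset_mult\<close>.\<close>

definition quot_algebra :: "('k, 'a, 'p) module_scheme \<Rightarrow> 'a set \<Rightarrow> ('k, 'a set) module"
  where "quot_algebra A I =
    \<lparr>carrier = carrier (A Quot I), mult = mult (A Quot I), one = one (A Quot I),
     zero = zero (A Quot I), add = add (A Quot I),
     smult = (\<lambda>c X. \<Union>a\<in>X. I +>\<^bsub>A\<^esub> (c \<odot>\<^bsub>A\<^esub> a))\<rparr>"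


section \<open>The tensor algebra\<close>

text \<open>The free algebra on a set \<open>S\<close>: finitely supported functions from words over \<open>S\<close> to the
  field, with the convolution product coming from concatenation of words.\<close>

definition free_algebra :: "('k, 'm) ring_scheme \<Rightarrow> 's set \<Rightarrow> ('k, 's list \<Rightarrow> 'k) module"
  where "free_algebra K S =
    \<lparr>carrier = {p. p \<in> UNIV \<rightarrow> carrier K \<and> finite {w. p w \<noteq> \<zero>\<^bsub>K\<^esub>} \<and> {w. p w \<noteq> \<zero>\<^bsub>K\<^esub>} \<subseteq> lists S},
     mult = (\<lambda>p q w. \<Oplus>\<^bsub>K\<^esub>i\<in>{..length w}. p (take i w) \<otimes>\<^bsub>K\<^esub> q (drop i w)),
     one = (\<lambda>w. if w = [] then \<one>\<^bsub>K\<^esub> else \<zero>\<^bsub>K\<^esub>),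
     zero = (\<lambda>w. \<zero>\<^bsub>K\<^esub>),
     add = (\<lambda>p q w. p w \<oplus>\<^bsub>K\<^esub> q w),
     smult = (\<lambda>c p w. c \<otimes>\<^bsub>K\<^esub> p w)\<rparr>"

definition letter :: "('k, 'm) ring_scheme \<Rightarrow> 's \<Rightarrow> 's list \<Rightarrow> 'k"
  where "letter K s = (\<lambda>w. if w = [s] then \<one>\<^bsub>K\<^esub> else \<zero>\<^bsub>K\<^esub>)"

text \<open>\<open>T(V)\<close> is the free algebra on the underlying set of \<open>V\<close> modulo the relations that make
  \<open>v \<mapsto> [v]\<close> linear. The ideal they generate is graded by word length, and its part of length \<open>m\<close>
  is spanned by the multilinearity relations, so the length-\<open>m\<close> part of the quotient is the usual
  construction of the \<open>m\<close>-fold tensor power of \<open>V\<close>: the free vector space on \<open>m\<close>-tuples of vectors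
  modulo multilinearity. The class of a word \<open>[v\<^sub>1, \<dots>, v\<^sub>m]\<close> is the tensor product of
  the \<open>v\<^sub>i\<close>, and the product of the quotient is the tensor product.\<close>

definition tensor_relations ::
    "('k, 'm) ring_scheme \<Rightarrow> ('k, 'v, 'p) module_scheme \<Rightarrow> ('v list \<Rightarrow> 'k) set"
  where "tensor_relations K V = (let F = free_algebra K (carrier V) in
      {letter K (u \<oplus>\<^bsub>V\<^esub> v) \<ominus>\<^bsub>F\<^esub> (letter K u \<oplus>\<^bsub>F\<^esub> letter K v) | u v.
         u \<in> carrier V \<and> v \<in> carrier V} \<union>
      {letter K (c \<odot>\<^bsub>V\<^esub> v) \<ominus>\<^bsub>F\<^esub> (c \<odot>\<^bsub>F\<^esub> letter K v) | c v.
         c \<in> carrier K \<and> v \<in> carrier V})"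

definition tensor_ideal ::
    "('k, 'm) ring_scheme \<Rightarrow> ('k, 'v, 'p) module_scheme \<Rightarrow> ('v list \<Rightarrow> 'k) set"
  where "tensor_ideal K V = Idl\<^bsub>free_algebra K (carrier V)\<^esub> (tensor_relations K V)"

definition tensor_algebra ::
    "('k, 'm) ring_scheme \<Rightarrow> ('k, 'v, 'p) module_scheme \<Rightarrow> ('k, ('v list \<Rightarrow> 'k) set) module"
  where "tensor_algebra K V = quot_algebra (free_algebra K (carrier V)) (tensor_ideal K V)"

definition tensor_incl ::
    "('k, 'm) ring_scheme \<Rightarrow> ('k, 'v, 'p) module_scheme \<Rightarrow> 'v \<Rightarrow> ('v list \<Rightarrow> 'k) set"
  where "tensor_incl K V v = tensor_ideal K V +>\<^bsub>free_algebra K (carrier V)\<^esub> letter K v"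


section \<open>Skew Clifford algebras\<close>

definition ring_characteristic :: "('k, 'm) ring_scheme \<Rightarrow> nat"
  where "ring_characteristic R =
    (if \<exists>m::nat. m > 0 \<and> [m] \<cdot>\<^bsub>R\<^esub> \<one>\<^bsub>R\<^esub> = \<zero>\<^bsub>R\<^esub>
     then LEAST m::nat. m > 0 \<and> [m] \<cdot>\<^bsub>R\<^esub> \<one>\<^bsub>R\<^esub> = \<zero>\<^bsub>R\<^esub> else 0)"

definition ordered_basis ::
    "('k, 'm) ring_scheme \<Rightarrow> ('k, 'v, 'p) module_scheme \<Rightarrow> nat \<Rightarrow> (nat \<Rightarrow> 'v) \<Rightarrow> bool"
  where "ordered_basis K V n x \<longleftrightarrow> inj_on x {1..n} \<and> vectorspace.basis K V (x ` {1..n})"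

definition mult_antisymmetric :: "('k, 'm) ring_scheme \<Rightarrow> nat \<Rightarrow> (nat \<Rightarrow> nat \<Rightarrow> 'k) \<Rightarrow> bool"
  where "mult_antisymmetric K n \<mu> \<longleftrightarrow>
    (\<forall>i\<in>{1..n}. \<forall>j\<in>{1..n}. \<mu> i j \<in> carrier K \<and> \<mu> i j \<otimes>\<^bsub>K\<^esub> \<mu> j i = \<one>\<^bsub>K\<^esub> \<and> \<mu> i i = \<one>\<^bsub>K\<^esub>)"

definition bilinear_form ::
    "('k, 'm) ring_scheme \<Rightarrow> ('k, 'v, 'p) module_scheme \<Rightarrow> ('v \<Rightarrow> 'v \<Rightarrow> 'k) \<Rightarrow> bool"
  where "bilinear_form K V \<phi> \<longleftrightarrow>
    (\<forall>u\<in>carrier V. \<forall>v\<in>carrier V. \<phi> u v \<in> carrier K) \<and>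
    (\<forall>u\<in>carrier V. \<forall>v\<in>carrier V. \<forall>w\<in>carrier V.
       \<phi> (u \<oplus>\<^bsub>V\<^esub> v) w = \<phi> u w \<oplus>\<^bsub>K\<^esub> \<phi> v w \<and> \<phi> w (u \<oplus>\<^bsub>V\<^esub> v) = \<phi> w u \<oplus>\<^bsub>K\<^esub> \<phi> w v) \<and>
    (\<forall>c\<in>carrier K. \<forall>u\<in>carrier V. \<forall>v\<in>carrier V.
       \<phi> (c \<odot>\<^bsub>V\<^esub> u) v = c \<otimes>\<^bsub>K\<^esub> \<phi> u v \<and> \<phi> u (c \<odot>\<^bsub>V\<^esub> v) = c \<otimes>\<^bsub>K\<^esub> \<phi> u v)"

definition mu_symmetric ::
    "('k, 'm) ring_scheme \<Rightarrow> nat \<Rightarrow> (nat \<Rightarrow> 'v) \<Rightarrow> (nat \<Rightarrow> nat \<Rightarrow> 'k) \<Rightarrow> ('v \<Rightarrow> 'v \<Rightarrow> 'k) \<Rightarrow> bool"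
  where "mu_symmetric K n x \<mu> \<phi> \<longleftrightarrow>
    (\<forall>i\<in>{1..n}. \<forall>j\<in>{1..n}. \<phi> (x i) (x j) = \<mu> i j \<otimes>\<^bsub>K\<^esub> \<phi> (x j) (x i))"

definition skew_clifford_ideal ::
    "('k, 'm) ring_scheme \<Rightarrow> ('k, 'v, 'p) module_scheme \<Rightarrow> nat \<Rightarrow> (nat \<Rightarrow> 'v) \<Rightarrow>
     (nat \<Rightarrow> nat \<Rightarrow> 'k) \<Rightarrow> ('v \<Rightarrow> 'v \<Rightarrow> 'k) \<Rightarrow> ('v list \<Rightarrow> 'k) set set"
  where "skew_clifford_ideal K V n x \<mu> \<phi> = (let T = tensor_algebra K V; \<iota> = tensor_incl K V in
    Idl\<^bsub>T\<^esub> {\<iota> (x i) \<otimes>\<^bsub>T\<^esub> \<iota> (x j) \<oplus>\<^bsub>T\<^esub> \<mu> i j \<odot>\<^bsub>T\<^esub> (\<iota> (x j) \<otimes>\<^bsub>T\<^esub> \<iota> (x i)) \<ominus>\<^bsub>T\<^esub>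
            ([(2::nat)] \<cdot>\<^bsub>K\<^esub> \<phi> (x i) (x j)) \<odot>\<^bsub>T\<^esub> \<one>\<^bsub>T\<^esub> | i j. i \<in> {1..n} \<and> j \<in> {1..n}})"

definition skew_clifford ::
    "('k, 'm) ring_scheme \<Rightarrow> ('k, 'v, 'p) module_scheme \<Rightarrow> nat \<Rightarrow> (nat \<Rightarrow> 'v) \<Rightarrow>
     (nat \<Rightarrow> nat \<Rightarrow> 'k) \<Rightarrow> ('v \<Rightarrow> 'v \<Rightarrow> 'k) \<Rightarrow> ('k, ('v list \<Rightarrow> 'k) set set) module"
  where "skew_clifford K V n x \<mu> \<phi> =
    quot_algebra (tensor_algebra K V) (skew_clifford_ideal K V n x \<mu> \<phi>)"

definition skew_clifford_incl ::
    "('k, 'm) ring_scheme \<Rightarrow> ('k, 'v, 'p) module_scheme \<Rightarrow> nat \<Rightarrow> (nat \<Rightarrow> 'v) \<Rightarrow>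
     (nat \<Rightarrow> nat \<Rightarrow> 'k) \<Rightarrow> ('v \<Rightarrow> 'v \<Rightarrow> 'k) \<Rightarrow> 'v \<Rightarrow> ('v list \<Rightarrow> 'k) set set"
  where "skew_clifford_incl K V n x \<mu> \<phi> v =
    skew_clifford_ideal K V n x \<mu> \<phi> +>\<^bsub>tensor_algebra K V\<^esub> tensor_incl K V v"


section \<open>The constructions yield algebras\<close>

text \<open>In particular, the ideals above are genuine ideals, so that \<^const>\<open>genideal\<close> and the coset
  operations have their intended meaning.\<close>

lemma ring_quot_algebra:
  assumes "ideal I A"
  shows "ring (quot_algebra A I)"
proof -
  interpret Q: ring "A Quot I" using ideal.quotient_is_ring[OF assms] .
  have "abelian_group (quot_algebra A I)"
    by (rule abelian_groupI)
      (simp_all add: quot_algebra_def Q.a_assoc Q.add.l_inv_ex, simp add: Q.a_comm)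
  moreover have "Group.monoid (quot_algebra A I)"
    by (rule monoidI) (auto simp: quot_algebra_def Q.m_assoc)
  ultimately show ?thesis
    by (rule ringI) (auto simp: quot_algebra_def Q.l_distr Q.r_distr)
qed

lemma (in assoc_algebra) quot_algebra_smult:
  assumes "ideal I A" "c \<in> carrier K" "a \<in> carrier A"
  shows "c \<odot>\<^bsub>quot_algebra A I\<^esub> (I +>\<^bsub>A\<^esub> a) = I +>\<^bsub>A\<^esub> (c \<odot>\<^bsub>A\<^esub> a)"
proof -
  interpret I: ideal I A by fact
  have "I +>\<^bsub>A\<^esub> (c \<odot>\<^bsub>A\<^esub> b) = I +>\<^bsub>A\<^esub> (c \<odot>\<^bsub>A\<^esub> a)" if "b \<in> I +>\<^bsub>A\<^esub> a" for b
  proof -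
    from that obtain h where h: "h \<in> I" "b = h \<oplus>\<^bsub>A\<^esub> a"
      by (auto simp: a_r_coset_def r_coset_def)
    have hc: "h \<in> carrier A" using h I.a_Hcarr by auto
    have "c \<odot>\<^bsub>A\<^esub> h = (c \<odot>\<^bsub>A\<^esub> \<one>\<^bsub>A\<^esub>) \<otimes>\<^bsub>A\<^esub> h"
      using smult_mult_left[of c "\<one>\<^bsub>A\<^esub>" h] assms hc by simp
    then have "c \<odot>\<^bsub>A\<^esub> h \<in> I" using I.I_l_closed h assms by simp
    moreover have "c \<odot>\<^bsub>A\<^esub> b = c \<odot>\<^bsub>A\<^esub> h \<oplus>\<^bsub>A\<^esub> c \<odot>\<^bsub>A\<^esub> a"
      using h hc assms smult_r_distr by simp
    ultimately have "c \<odot>\<^bsub>A\<^esub> b \<in> I +>\<^bsub>A\<^esub> (c \<odot>\<^bsub>A\<^esub> a)"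
      by (auto simp: a_r_coset_def r_coset_def)
    then show ?thesis using abelian_group.a_repr_independence[OF ring.is_abelian_group[OF ideal.axioms(2)[OF assms(1)]] _
          smult_closed[OF assms(2,3)] I.a_subgroup] by simp
  qed
  moreover have "I +>\<^bsub>A\<^esub> a \<noteq> {}" using I.a_rcos_self assms by blast
  ultimately have "(\<Union>b\<in>I +>\<^bsub>A\<^esub> a. I +>\<^bsub>A\<^esub> (c \<odot>\<^bsub>A\<^esub> b)) = I +>\<^bsub>A\<^esub> (c \<odot>\<^bsub>A\<^esub> a)"
    by (rule SUP_eq_const[rotated])
  then show ?thesis by (simp add: quot_algebra_def)
qed

lemma (in assoc_algebra) assoc_algebra_quot_algebra:
  assumes "ideal I A"
  shows "assoc_algebra K (quot_algebra A I)"
proof -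
  interpret I: ideal I A by fact
  interpret Q: ring "quot_algebra A I" by (rule ring_quot_algebra) fact
  have car: "carrier (quot_algebra A I) = (\<lambda>a. I +>\<^bsub>A\<^esub> a) ` carrier A"
    by (auto simp: quot_algebra_def FactRing_simps)
  have add: "(I +>\<^bsub>A\<^esub> a) \<oplus>\<^bsub>quot_algebra A I\<^esub> (I +>\<^bsub>A\<^esub> b) = I +>\<^bsub>A\<^esub> (a \<oplus>\<^bsub>A\<^esub> b)"
    if "a \<in> carrier A" "b \<in> carrier A" for a b
    using that by (simp add: quot_algebra_def FactRing_simps I.a_rcos_sum)
  have mult: "(I +>\<^bsub>A\<^esub> a) \<otimes>\<^bsub>quot_algebra A I\<^esub> (I +>\<^bsub>A\<^esub> b) = I +>\<^bsub>A\<^esub> (a \<otimes>\<^bsub>A\<^esub> b)"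
    if "a \<in> carrier A" "b \<in> carrier A" for a b
    using that by (simp add: quot_algebra_def FactRing_simps I.rcoset_mult_add)
  note S = quot_algebra_smult[OF assms]
  have "module K (quot_algebra A I)"
    by (rule moduleI)
      (auto simp: car S add R.is_cring Q.abelian_group_axioms smult_l_distr smult_r_distr smult_assoc1)
  then have "vectorspace K (quot_algebra A I)"
    using field_axioms by (simp add: vectorspace_def)
  then show ?thesis
    by (intro assoc_algebra.intro assoc_algebra_axioms.intro Q.ring_axioms)
      (auto simp: car S mult smult_mult_left smult_mult_right)
qed

lemma (in abelian_monoid) finsum_triangle:
  assumes F: "\<And>i j. F i j \<in> carrier G"
  shows "(\<Oplus>j\<in>{..k::nat}. \<Oplus>i\<in>{..j}. F i (j - i)) = (\<Oplus>i\<in>{..k}. \<Oplus>j\<in>{..k - i}. F i j)"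
proof (induction k)
  case 0
  show ?case using F by simp
next
  case (Suc k)
  have "(\<Oplus>j\<in>{..Suc k - i}. F i j) = F i (Suc k - i) \<oplus> (\<Oplus>j\<in>{..k - i}. F i j)" if "i \<le> k" for i
    using F that by (simp add: Suc_diff_le)
  then have "(\<Oplus>i\<in>{..k}. \<Oplus>j\<in>{..Suc k - i}. F i j) =
      (\<Oplus>i\<in>{..k}. F i (Suc k - i) \<oplus> (\<Oplus>j\<in>{..k - i}. F i j))"
    using F by (intro finsum_cong') auto
  also have "\<dots> = (\<Oplus>i\<in>{..k}. F i (Suc k - i)) \<oplus> (\<Oplus>i\<in>{..k}. \<Oplus>j\<in>{..k - i}. F i j)"
    using F by (intro finsum_addf) auto
  finally have 1: "(\<Oplus>i\<in>{..k}. \<Oplus>j\<in>{..Suc k - i}. F i j) =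
    (\<Oplus>i\<in>{..k}. F i (Suc k - i)) \<oplus> (\<Oplus>i\<in>{..k}. \<Oplus>j\<in>{..k - i}. F i j)" .
  have 2: "(\<Oplus>i\<in>{..Suc k}. \<Oplus>j\<in>{..Suc k - i}. F i j) =
      (\<Oplus>j\<in>{..0}. F (Suc k) j) \<oplus> (\<Oplus>i\<in>{..k}. \<Oplus>j\<in>{..Suc k - i}. F i j)"
    using F by (subst finsum_Suc) auto
  have 3: "(\<Oplus>j\<in>{..Suc k}. \<Oplus>i\<in>{..j}. F i (j - i)) =
     (F (Suc k) 0 \<oplus> (\<Oplus>i\<in>{..k}. F i (Suc k - i))) \<oplus> (\<Oplus>j\<in>{..k}. \<Oplus>i\<in>{..j}. F i (j - i))"
    using F by (subst finsum_Suc) (auto simp del: finsum_Suc simp: finsum_Suc[where n=k])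
  have "(\<Oplus>j\<in>{..0}. F (Suc k) j) = F (Suc k) 0" using F by simp
  then show ?case unfolding 3 2 1 Suc using F by (simp add: a_assoc)
qed

lemma assoc_algebra_free_algebra:
  assumes "field K"
  shows "assoc_algebra K (free_algebra K S)"
proof -
  interpret K: field K by fact
  let ?F = "free_algebra K S"
  have car: "p \<in> carrier ?F \<longleftrightarrow>
      (\<forall>w. p w \<in> carrier K) \<and> finite {w. p w \<noteq> \<zero>\<^bsub>K\<^esub>} \<and> {w. p w \<noteq> \<zero>\<^bsub>K\<^esub>} \<subseteq> lists S" for p
    by (auto simp: free_algebra_def)
  have add_def: "p \<oplus>\<^bsub>?F\<^esub> q = (\<lambda>w. p w \<oplus>\<^bsub>K\<^esub> q w)" for p q by (simp add: free_algebra_def)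
  have zero_def: "\<zero>\<^bsub>?F\<^esub> = (\<lambda>w. \<zero>\<^bsub>K\<^esub>)" by (simp add: free_algebra_def)
  have smult_def: "c \<odot>\<^bsub>?F\<^esub> p = (\<lambda>w. c \<otimes>\<^bsub>K\<^esub> p w)" for c p by (simp add: free_algebra_def)
  have mult_def: "p \<otimes>\<^bsub>?F\<^esub> q = (\<lambda>w. \<Oplus>\<^bsub>K\<^esub>i\<in>{..length w}. p (take i w) \<otimes>\<^bsub>K\<^esub> q (drop i w))" for p q
    by (simp add: free_algebra_def)
  have one_def: "\<one>\<^bsub>?F\<^esub> = (\<lambda>w. if w = [] then \<one>\<^bsub>K\<^esub> else \<zero>\<^bsub>K\<^esub>)" by (simp add: free_algebra_def)
  have sub: "p \<in> carrier ?F" if "\<And>w. p w \<in> carrier K" "{w. p w \<noteq> \<zero>\<^bsub>K\<^esub>} \<subseteq> T" "finite T" "T \<subseteq> lists S" for p T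
    using that unfolding car by (meson finite_subset order_trans)
  have addc: "p \<oplus>\<^bsub>?F\<^esub> q \<in> carrier ?F" if "p \<in> carrier ?F" "q \<in> carrier ?F" for p q
    by (rule sub[of _ "{w. p w \<noteq> \<zero>\<^bsub>K\<^esub>} \<union> {w. q w \<noteq> \<zero>\<^bsub>K\<^esub>}"])
      (use that in \<open>auto simp: car add_def\<close>)
  have smultc: "c \<odot>\<^bsub>?F\<^esub> p \<in> carrier ?F" if "c \<in> carrier K" "p \<in> carrier ?F" for c p
    by (rule sub[of _ "{w. p w \<noteq> \<zero>\<^bsub>K\<^esub>}"]) (use that in \<open>auto simp: car smult_def\<close>)
  have zeroc: "\<zero>\<^bsub>?F\<^esub> \<in> carrier ?F" by (simp add: car zero_def)
  have onec: "\<one>\<^bsub>?F\<^esub> \<in> carrier ?F"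
    by (rule sub[of _ "{[]}"]) (auto simp: one_def)
  have multc: "p \<otimes>\<^bsub>?F\<^esub> q \<in> carrier ?F" if "p \<in> carrier ?F" "q \<in> carrier ?F" for p q
  proof (rule sub)
    let ?T = "(\<lambda>(u, v). u @ v) ` ({w. p w \<noteq> \<zero>\<^bsub>K\<^esub>} \<times> {w. q w \<noteq> \<zero>\<^bsub>K\<^esub>})"
    show "(p \<otimes>\<^bsub>?F\<^esub> q) w \<in> carrier K" for w
      using that by (auto simp: car mult_def intro!: K.finsum_closed)
    show "finite ?T" using that by (auto simp: car)
    show "?T \<subseteq> lists S" using that by (fastforce simp: car)
    show "{w. (p \<otimes>\<^bsub>?F\<^esub> q) w \<noteq> \<zero>\<^bsub>K\<^esub>} \<subseteq> ?T"
    proof (rule ccontr)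
      assume "\<not> ?thesis"
      then obtain w where w: "(p \<otimes>\<^bsub>?F\<^esub> q) w \<noteq> \<zero>\<^bsub>K\<^esub>" "w \<notin> ?T" by auto
      have "p (take i w) \<otimes>\<^bsub>K\<^esub> q (drop i w) = \<zero>\<^bsub>K\<^esub>" for i
      proof (rule ccontr)
        assume "p (take i w) \<otimes>\<^bsub>K\<^esub> q (drop i w) \<noteq> \<zero>\<^bsub>K\<^esub>"
        then have "p (take i w) \<noteq> \<zero>\<^bsub>K\<^esub>" "q (drop i w) \<noteq> \<zero>\<^bsub>K\<^esub>"
          using that by (auto simp: car)
        then have "w \<in> ?T" by (auto intro!: image_eqI[of _ _ "(take i w, drop i w)"])
        then show False using w by simp
      qed
      then show False using w by (simp add: mult_def)
    qed
  qed
  have neg: "\<exists>q\<in>carrier ?F. q \<oplus>\<^bsub>?F\<^esub> p = \<zero>\<^bsub>?F\<^esub>" if "p \<in> carrier ?F" for p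
  proof (rule bexI[of _ "(\<ominus>\<^bsub>K\<^esub> \<one>\<^bsub>K\<^esub>) \<odot>\<^bsub>?F\<^esub> p"])
    show "(\<ominus>\<^bsub>K\<^esub> \<one>\<^bsub>K\<^esub>) \<odot>\<^bsub>?F\<^esub> p \<in> carrier ?F" using that by (simp add: smultc)
    show "(\<ominus>\<^bsub>K\<^esub> \<one>\<^bsub>K\<^esub>) \<odot>\<^bsub>?F\<^esub> p \<oplus>\<^bsub>?F\<^esub> p = \<zero>\<^bsub>?F\<^esub>"
      using that by (auto simp: car add_def smult_def zero_def K.l_minus K.l_neg)
  qed
  have ab: "abelian_group ?F"
  proof (rule abelian_groupI)
    show "\<exists>q\<in>carrier ?F. q \<oplus>\<^bsub>?F\<^esub> p = \<zero>\<^bsub>?F\<^esub>" if "p \<in> carrier ?F" for p using neg[OF that] .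
  qed (auto simp: addc zeroc, auto simp: car add_def zero_def K.a_assoc, auto simp: K.a_comm)
  have "module K ?F"
    by (rule moduleI[OF K.is_cring ab smultc])
      (auto simp: car smult_def add_def K.l_distr K.r_distr K.m_assoc)
  then have vs: "vectorspace K ?F" using assms by (simp add: vectorspace_def)
  have mon: "Group.monoid ?F"
  proof (rule monoidI)
    fix p q r assume c: "p \<in> carrier ?F" "q \<in> carrier ?F" "r \<in> carrier ?F"
    then have [simp]: "p w \<in> carrier K" "q w \<in> carrier K" "r w \<in> carrier K" for w by (auto simp: car)
    show "(p \<otimes>\<^bsub>?F\<^esub> q) \<otimes>\<^bsub>?F\<^esub> r = p \<otimes>\<^bsub>?F\<^esub> (q \<otimes>\<^bsub>?F\<^esub> r)"
    proof
      fix w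
      let ?G = "\<lambda>i l. p (take i w) \<otimes>\<^bsub>K\<^esub> (q (take l (drop i w)) \<otimes>\<^bsub>K\<^esub> r (drop (i + l) w))"
      have "((p \<otimes>\<^bsub>?F\<^esub> q) \<otimes>\<^bsub>?F\<^esub> r) w =
          (\<Oplus>\<^bsub>K\<^esub>j\<in>{..length w}. \<Oplus>\<^bsub>K\<^esub>i\<in>{..j}. ?G i (j - i))"
        unfolding mult_def
      proof (rule K.finsum_cong', simp, simp)
        fix j assume "j \<in> {..length w}"
        then have j: "j \<le> length w" by simp
        have "(\<Oplus>\<^bsub>K\<^esub>i\<in>{..length (take j w)}. p (take i (take j w)) \<otimes>\<^bsub>K\<^esub> q (drop i (take j w))) \<otimes>\<^bsub>K\<^esub> r (drop j w)
          = (\<Oplus>\<^bsub>K\<^esub>i\<in>{..length (take j w)}. (p (take i (take j w)) \<otimes>\<^bsub>K\<^esub> q (drop i (take j w))) \<otimes>\<^bsub>K\<^esub> r (drop j w))"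
          by (rule K.finsum_ldistr) auto
        also have "\<dots> = (\<Oplus>\<^bsub>K\<^esub>i\<in>{..j}. ?G i (j - i))"
          using j by (intro K.finsum_cong') (auto simp: drop_take K.m_assoc min_def)
        finally show "(\<Oplus>\<^bsub>K\<^esub>i\<in>{..length (take j w)}. p (take i (take j w)) \<otimes>\<^bsub>K\<^esub> q (drop i (take j w))) \<otimes>\<^bsub>K\<^esub> r (drop j w)
          = (\<Oplus>\<^bsub>K\<^esub>i\<in>{..j}. ?G i (j - i))" .
      qed
      also have "\<dots> = (\<Oplus>\<^bsub>K\<^esub>i\<in>{..length w}. \<Oplus>\<^bsub>K\<^esub>l\<in>{..length w - i}. ?G i l)"
        by (rule K.finsum_triangle) simp
      also have "\<dots> = (p \<otimes>\<^bsub>?F\<^esub> (q \<otimes>\<^bsub>?F\<^esub> r)) w"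
        unfolding mult_def
      proof (rule K.finsum_cong', simp, simp)
        fix i assume "i \<in> {..length w}"
        have "p (take i w) \<otimes>\<^bsub>K\<^esub> (\<Oplus>\<^bsub>K\<^esub>l\<in>{..length (drop i w)}. q (take l (drop i w)) \<otimes>\<^bsub>K\<^esub> r (drop l (drop i w)))
          = (\<Oplus>\<^bsub>K\<^esub>l\<in>{..length (drop i w)}. p (take i w) \<otimes>\<^bsub>K\<^esub> (q (take l (drop i w)) \<otimes>\<^bsub>K\<^esub> r (drop l (drop i w))))"
          by (rule K.finsum_rdistr) auto
        also have "\<dots> = (\<Oplus>\<^bsub>K\<^esub>l\<in>{..length w - i}. ?G i l)"
          by (intro K.finsum_cong') (auto simp: add.commute)
        finally show "(\<Oplus>\<^bsub>K\<^esub>l\<in>{..length w - i}. ?G i l) =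
          p (take i w) \<otimes>\<^bsub>K\<^esub> (\<Oplus>\<^bsub>K\<^esub>l\<in>{..length (drop i w)}. q (take l (drop i w)) \<otimes>\<^bsub>K\<^esub> r (drop l (drop i w)))" by simp
      qed
      finally show "((p \<otimes>\<^bsub>?F\<^esub> q) \<otimes>\<^bsub>?F\<^esub> r) w = (p \<otimes>\<^bsub>?F\<^esub> (q \<otimes>\<^bsub>?F\<^esub> r)) w" .
    qed
    show "\<one>\<^bsub>?F\<^esub> \<otimes>\<^bsub>?F\<^esub> p = p"
    proof
      fix w
      have "(\<one>\<^bsub>?F\<^esub> \<otimes>\<^bsub>?F\<^esub> p) w = (\<Oplus>\<^bsub>K\<^esub>i\<in>{..length w}. if i = 0 then p w else \<zero>\<^bsub>K\<^esub>)"
        unfolding mult_def one_def by (intro K.finsum_cong') auto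
      also have "\<dots> = p w"
        using K.add.finprod_singleton_swap[of 0 "{..length w}" "\<lambda>_. p w"] by (simp add: eq_commute)
      finally show "(\<one>\<^bsub>?F\<^esub> \<otimes>\<^bsub>?F\<^esub> p) w = p w" .
    qed
    show "p \<otimes>\<^bsub>?F\<^esub> \<one>\<^bsub>?F\<^esub> = p"
    proof
      fix w
      have "(p \<otimes>\<^bsub>?F\<^esub> \<one>\<^bsub>?F\<^esub>) w = (\<Oplus>\<^bsub>K\<^esub>i\<in>{..length w}. if i = length w then p w else \<zero>\<^bsub>K\<^esub>)"
        unfolding mult_def one_def by (intro K.finsum_cong') auto
      also have "\<dots> = p w"
        using K.add.finprod_singleton_swap[of "length w" "{..length w}" "\<lambda>_. p w"] by (simp add: eq_commute)
      finally show "(p \<otimes>\<^bsub>?F\<^esub> \<one>\<^bsub>?F\<^esub>) w = p w" .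
    qed
  qed (auto simp: multc onec)
  have "ring ?F"
  proof (rule ringI[OF ab mon])
    fix p q r assume c: "p \<in> carrier ?F" "q \<in> carrier ?F" "r \<in> carrier ?F"
    then have [simp]: "p w \<in> carrier K" "q w \<in> carrier K" "r w \<in> carrier K" for w by (auto simp: car)
    show "(p \<oplus>\<^bsub>?F\<^esub> q) \<otimes>\<^bsub>?F\<^esub> r = p \<otimes>\<^bsub>?F\<^esub> r \<oplus>\<^bsub>?F\<^esub> q \<otimes>\<^bsub>?F\<^esub> r"
      unfolding mult_def add_def by (simp add: K.l_distr K.finsum_addf)
    show "r \<otimes>\<^bsub>?F\<^esub> (p \<oplus>\<^bsub>?F\<^esub> q) = r \<otimes>\<^bsub>?F\<^esub> p \<oplus>\<^bsub>?F\<^esub> r \<otimes>\<^bsub>?F\<^esub> q"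
      unfolding mult_def add_def by (simp add: K.r_distr K.finsum_addf)
  qed
  then show ?thesis
  proof (intro assoc_algebra.intro[OF vs] assoc_algebra_axioms.intro)
    fix c p q assume c: "c \<in> carrier K" "p \<in> carrier ?F" "q \<in> carrier ?F"
    then have [simp]: "p w \<in> carrier K" "q w \<in> carrier K" for w by (auto simp: car)
    show "(c \<odot>\<^bsub>?F\<^esub> p) \<otimes>\<^bsub>?F\<^esub> q = c \<odot>\<^bsub>?F\<^esub> (p \<otimes>\<^bsub>?F\<^esub> q)"
      unfolding mult_def smult_def using c by (simp add: K.finsum_rdistr K.m_assoc)
    show "p \<otimes>\<^bsub>?F\<^esub> (c \<odot>\<^bsub>?F\<^esub> q) = c \<odot>\<^bsub>?F\<^esub> (p \<otimes>\<^bsub>?F\<^esub> q)"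
      unfolding mult_def smult_def using c by (simp add: K.finsum_rdistr K.m_lcomm)
  qed
qed

lemma letter_carrier: "field K \<Longrightarrow> s \<in> S \<Longrightarrow> letter K s \<in> carrier (free_algebra K S)"
proof -
  assume K: "field K" "s \<in> S"
  then interpret K: field K by simp
  show ?thesis using K by (auto simp: free_algebra_def letter_def)
qed

lemma ideal_tensor_ideal:
  assumes "vectorspace K V"
  shows "ideal (tensor_ideal K V) (free_algebra K (carrier V))"
proof -
  interpret V: vectorspace K V by fact
  interpret F: assoc_algebra K "free_algebra K (carrier V)"
    by (rule assoc_algebra_free_algebra) (rule V.field_axioms)
  have "tensor_relations K V \<subseteq> carrier (free_algebra K (carrier V))"
    unfolding tensor_relations_def Let_def
    by (auto intro!: F.minus_closed F.a_closed F.smult_closed letter_carrier V.field_axioms)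
  then show ?thesis unfolding tensor_ideal_def by (rule F.genideal_ideal)
qed

lemma assoc_algebra_tensor_algebra:
  assumes "vectorspace K V"
  shows "assoc_algebra K (tensor_algebra K V)"
proof -
  have "field K" using assms by (simp add: vectorspace_def)
  then show ?thesis unfolding tensor_algebra_def
    by (rule assoc_algebra.assoc_algebra_quot_algebra[OF assoc_algebra_free_algebra ideal_tensor_ideal[OF assms]])
qed

lemma tensor_incl_carrier:
  assumes "vectorspace K V" "v \<in> carrier V"
  shows "tensor_incl K V v \<in> carrier (tensor_algebra K V)"
proof -
  have "field K" using assms by (simp add: vectorspace_def)
  then have "letter K v \<in> carrier (free_algebra K (carrier V))"
    using assms(2) by (rule letter_carrier)
  then show ?thesis
    unfolding tensor_incl_def tensor_algebra_def quot_algebra_def FactRing_simps by simp blast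
qed

lemma (in vectorspace) add_nat_pow_closed: "a \<in> carrier K \<Longrightarrow> [(k::nat)] \<cdot>\<^bsub>K\<^esub> a \<in> carrier K"
proof -
  interpret K: abelian_monoid K by (rule abelian_group.axioms(1), rule ring.is_abelian_group, rule cring.axioms(1), rule module.axioms(1), rule module_axioms)
  assume "a \<in> carrier K"
  then show ?thesis by (induction k) (auto simp: add_pow_def)
qed

lemma ideal_skew_clifford_ideal:
  assumes "vectorspace K V" "ordered_basis K V n x" "mult_antisymmetric K n \<mu>" "bilinear_form K V \<phi>"
  shows "ideal (skew_clifford_ideal K V n x \<mu> \<phi>) (tensor_algebra K V)"
proof -
  interpret V: vectorspace K V by fact
  interpret T: assoc_algebra K "tensor_algebra K V"
    by (rule assoc_algebra_tensor_algebra) fact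
  have x: "x i \<in> carrier V" if "i \<in> {1..n}" for i
    using assms(2) that unfolding ordered_basis_def V.basis_def by blast
  have \<iota>: "tensor_incl K V (x i) \<in> carrier (tensor_algebra K V)" if "i \<in> {1..n}" for i
    using assms(1) x[OF that] by (rule tensor_incl_carrier)
  have \<mu>: "\<mu> i j \<in> carrier K" if "i \<in> {1..n}" "j \<in> {1..n}" for i j
    using assms(3) that unfolding mult_antisymmetric_def by blast
  have \<phi>: "[(2::nat)] \<cdot>\<^bsub>K\<^esub> \<phi> (x i) (x j) \<in> carrier K" if "i \<in> {1..n}" "j \<in> {1..n}" for i j
    using assms(4) x that unfolding bilinear_form_def by (intro V.add_nat_pow_closed) blast
  show ?thesis unfolding skew_clifford_ideal_def Let_def
  proof (rule T.genideal_ideal, clarify)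
    fix i j assume "i \<in> {1..n}" "j \<in> {1..n}"
    then show "tensor_incl K V (x i) \<otimes>\<^bsub>tensor_algebra K V\<^esub> tensor_incl K V (x j) \<oplus>\<^bsub>tensor_algebra K V\<^esub>
        \<mu> i j \<odot>\<^bsub>tensor_algebra K V\<^esub>
          (tensor_incl K V (x j) \<otimes>\<^bsub>tensor_algebra K V\<^esub> tensor_incl K V (x i)) \<ominus>\<^bsub>tensor_algebra K V\<^esub>
        ([(2::nat)] \<cdot>\<^bsub>K\<^esub> \<phi> (x i) (x j)) \<odot>\<^bsub>tensor_algebra K V\<^esub> \<one>\<^bsub>tensor_algebra K V\<^esub>
        \<in> carrier (tensor_algebra K V)"
      by (intro T.minus_closed T.a_closed T.m_closed T.smult_closed T.A.one_closed \<iota> \<mu> \<phi>)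
  qed
qed

lemma assoc_algebra_skew_clifford:
  assumes "vectorspace K V" "ordered_basis K V n x" "mult_antisymmetric K n \<mu>" "bilinear_form K V \<phi>"
  shows "assoc_algebra K (skew_clifford K V n x \<mu> \<phi>)"
  unfolding skew_clifford_def
  by (rule assoc_algebra.assoc_algebra_quot_algebra[OF assoc_algebra_tensor_algebra ideal_skew_clifford_ideal])
    fact+

end

theory Submission
  imports Defs
begin

text \<open>The skew Clifford algebra is obtained from a free algebra by two successive quotients, and a
  free algebra and a quotient each have a universal property; the theorem is their composite.

  \<^item> A map from a set \<open>S\<close> into an algebra \<open>A\<close> extends to a homomorphism from the free algebra on
    \<open>S\<close>, which replaces each word by the product of the images of its letters
    (\<open>free_eval_hom\<close>). Since the free algebra is spanned by words (\<open>free_algebra_induct\<close>) and a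
    word is a product of letters, a homomorphism is determined by its values on letters
    (\<open>free_algebra_hom_unique\<close>).
  \<^item> A homomorphism that sends generators of an ideal to zero descends to the quotient
    (\<open>quot_genideal_lift\<close>), and it does so uniquely because the projection is onto.

  For a linear map \<open>f\<close> from \<open>V\<close> to \<open>A\<close>, linearity says exactly that its extension to the free
  algebra on the set \<open>V\<close> kills the relations that define the tensor algebra. The extension
  therefore descends to \<open>T(V)\<close> (\<open>tensor_algebra_lift\<close>). The resulting map sends the generator
  of the skew Clifford ideal with indices \<open>i\<close> and \<open>j\<close> to the same expression formed
  from \<open>f x\<^sub>i\<close> and \<open>f x\<^sub>j\<close> (\<open>skew_relation_hom\<close>), which is zero by hypothesis, so it
  descends once more. The relations hold in the skew Clifford algebra itself by the same computation
  applied to the projection from \<open>T(V)\<close>, which kills the generators.\<close>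

section \<open>Algebra homomorphisms and quotients\<close>

lemma algebra_hom_closed: "h \<in> algebra_hom K A B \<Longrightarrow> a \<in> carrier A \<Longrightarrow> h a \<in> carrier B"
  by (auto simp: algebra_hom_def ring_hom_def)

lemma algebra_hom_mult:
  "h \<in> algebra_hom K A B \<Longrightarrow> a \<in> carrier A \<Longrightarrow> b \<in> carrier A \<Longrightarrow>
    h (a \<otimes>\<^bsub>A\<^esub> b) = h a \<otimes>\<^bsub>B\<^esub> h b"
  by (auto simp: algebra_hom_def ring_hom_def)

lemma algebra_hom_add:
  "h \<in> algebra_hom K A B \<Longrightarrow> a \<in> carrier A \<Longrightarrow> b \<in> carrier A \<Longrightarrow>
    h (a \<oplus>\<^bsub>A\<^esub> b) = h a \<oplus>\<^bsub>B\<^esub> h b"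
  by (auto simp: algebra_hom_def ring_hom_def)

lemma algebra_hom_one: "h \<in> algebra_hom K A B \<Longrightarrow> h \<one>\<^bsub>A\<^esub> = \<one>\<^bsub>B\<^esub>"
  by (auto simp: algebra_hom_def ring_hom_def)

lemma algebra_hom_smult:
  "h \<in> algebra_hom K A B \<Longrightarrow> c \<in> carrier K \<Longrightarrow> a \<in> carrier A \<Longrightarrow>
    h (c \<odot>\<^bsub>A\<^esub> a) = c \<odot>\<^bsub>B\<^esub> h a"
  by (auto simp: algebra_hom_def module_hom_def)

lemmas algebra_hom_simps =
  algebra_hom_closed algebra_hom_mult algebra_hom_add algebra_hom_one algebra_hom_smult

lemma algebra_homI:
  assumes "\<And>a. a \<in> carrier A \<Longrightarrow> h a \<in> carrier B"
    and "\<And>a b. a \<in> carrier A \<Longrightarrow> b \<in> carrier A \<Longrightarrow> h (a \<otimes>\<^bsub>A\<^esub> b) = h a \<otimes>\<^bsub>B\<^esub> h b"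
    and "\<And>a b. a \<in> carrier A \<Longrightarrow> b \<in> carrier A \<Longrightarrow> h (a \<oplus>\<^bsub>A\<^esub> b) = h a \<oplus>\<^bsub>B\<^esub> h b"
    and "\<And>c a. c \<in> carrier K \<Longrightarrow> a \<in> carrier A \<Longrightarrow> h (c \<odot>\<^bsub>A\<^esub> a) = c \<odot>\<^bsub>B\<^esub> h a"
    and "h \<one>\<^bsub>A\<^esub> = \<one>\<^bsub>B\<^esub>"
  shows "h \<in> algebra_hom K A B"
  using assms by (simp add: algebra_hom_def module_hom_def ring_hom_def)

lemma algebra_hom_ring_hom_ring:
  assumes "assoc_algebra K A" "assoc_algebra K B" "h \<in> algebra_hom K A B"
  shows "ring_hom_ring A B h"
  using assms
  by (auto intro!: ring_hom_ringI2 simp: assoc_algebra_def algebra_hom_def)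

lemma algebra_hom_minus:
  assumes "assoc_algebra K A" "assoc_algebra K B" "h \<in> algebra_hom K A B"
    and "a \<in> carrier A" "b \<in> carrier A"
  shows "h (a \<ominus>\<^bsub>A\<^esub> b) = h a \<ominus>\<^bsub>B\<^esub> h b"
proof -
  interpret h: ring_hom_ring A B h by (rule algebra_hom_ring_hom_ring) fact+
  show ?thesis using assms by (simp add: a_minus_def)
qed

lemma algebra_hom_comp:
  "h \<in> algebra_hom K A B \<Longrightarrow> k \<in> algebra_hom K B C \<Longrightarrow> (\<lambda>a. k (h a)) \<in> algebra_hom K A C"
  by (rule algebra_homI) (simp_all add: algebra_hom_simps)

lemma algebra_hom_restrict:
  assumes "assoc_algebra K A" "h \<in> algebra_hom K A B"
  shows "restrict h (carrier A) \<in> algebra_hom K A B"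
proof -
  interpret A: assoc_algebra K A by fact
  show ?thesis by (rule algebra_homI) (simp_all add: assms(2)[THEN algebra_hom_closed]
    assms(2)[THEN algebra_hom_mult] assms(2)[THEN algebra_hom_add]
    assms(2)[THEN algebra_hom_one] assms(2)[THEN algebra_hom_smult])
qed

lemma carrier_quot_algebra: "carrier (quot_algebra A I) = (\<lambda>a. I +>\<^bsub>A\<^esub> a) ` carrier A"
  by (auto simp: quot_algebra_def FactRing_simps)

lemma quot_projection_hom:
  assumes "assoc_algebra K A" "ideal I A"
  shows "(\<lambda>a. I +>\<^bsub>A\<^esub> a) \<in> algebra_hom K A (quot_algebra A I)"
proof -
  interpret A: assoc_algebra K A by fact
  interpret I: ideal I A by fact
  show ?thesis
  proof (rule algebra_homI)
    show "I +>\<^bsub>A\<^esub> (c \<odot>\<^bsub>A\<^esub> a) = c \<odot>\<^bsub>quot_algebra A I\<^esub> (I +>\<^bsub>A\<^esub> a)"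
      if "c \<in> carrier K" "a \<in> carrier A" for c a
      using A.quot_algebra_smult[OF assms(2) that] by simp
  qed (auto simp: carrier_quot_algebra,
       simp_all add: quot_algebra_def FactRing_simps I.rcoset_mult_add I.a_rcos_sum)
qed

text \<open>The kernel of \<open>h\<close> is an ideal, so it contains the whole ideal as soon as it contains
  generators; then \<open>h\<close> is constant on cosets, and the induced map sends a coset to the only
  element of its image under \<open>h\<close>.\<close>

lemma quot_genideal_lift:
  assumes "assoc_algebra K A" "assoc_algebra K B" "h \<in> algebra_hom K A B"
    and R: "R \<subseteq> carrier A" "\<And>r. r \<in> R \<Longrightarrow> h r = \<zero>\<^bsub>B\<^esub>"
  shows "\<exists>k\<in>algebra_hom K (quot_algebra A (Idl\<^bsub>A\<^esub> R)) B. \<forall>a\<in>carrier A. k (Idl\<^bsub>A\<^esub> R +>\<^bsub>A\<^esub> a) = h a"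
proof -
  interpret A: assoc_algebra K A by fact
  interpret h: ring_hom_ring A B h by (rule algebra_hom_ring_hom_ring) fact+
  define I where "I = Idl\<^bsub>A\<^esub> R"
  have I: "ideal I A" unfolding I_def using R(1) by (rule A.genideal_ideal)
  interpret I: ideal I A by (rule I)
  have "R \<subseteq> a_kernel A B h" unfolding a_kernel_def' using R by blast
  then have "I \<subseteq> a_kernel A B h" unfolding I_def by (rule A.genideal_minimal[OF h.kernel_is_ideal])
  then have "h b = h a" if "a \<in> carrier A" "b \<in> I +>\<^bsub>A\<^esub> a" for a b
    using that by (intro h.rcos_imp_homeq) (auto simp: a_r_coset_def r_coset_def)
  then have "h ` (I +>\<^bsub>A\<^esub> a) = {h a}" if "a \<in> carrier A" for a
    using that I.a_rcos_self by blast
  then have k: "the_elem (h ` (I +>\<^bsub>A\<^esub> a)) = h a" if "a \<in> carrier A" for a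
    using that by simp
  note p = quot_projection_hom[OF assms(1) I]
  have "(\<lambda>X. the_elem (h ` X)) \<in> algebra_hom K (quot_algebra A I) B"
    by (rule algebra_homI)
      (auto simp: carrier_quot_algebra k assms(3)[THEN algebra_hom_smult]
        p[THEN algebra_hom_mult, symmetric] p[THEN algebra_hom_add, symmetric]
        p[THEN algebra_hom_one, symmetric] p[THEN algebra_hom_smult, symmetric])
  then show ?thesis unfolding I_def[symmetric] using k by (intro bexI[of _ "\<lambda>X. the_elem (h ` X)"]) simp_all
qed

section \<open>The free algebra\<close>

definition word :: "('k, 'm) ring_scheme \<Rightarrow> 's list \<Rightarrow> 's list \<Rightarrow> 'k"
  where "word K u = (\<lambda>w. if w = u then \<one>\<^bsub>K\<^esub> else \<zero>\<^bsub>K\<^esub>)"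

lemma letter_eq_word: "letter K s = word K [s]"
  by (simp add: letter_def word_def)

lemma one_eq_word: "\<one>\<^bsub>free_algebra K S\<^esub> = word K []"
  by (simp add: free_algebra_def word_def)

lemma word_carrier:
  assumes "field K" "u \<in> lists S"
  shows "word K u \<in> carrier (free_algebra K S)"
proof -
  interpret K: field K by fact
  show ?thesis using assms(2) by (auto simp: free_algebra_def word_def)
qed

lemma letter_mult_word:
  assumes "field K"
  shows "letter K s \<otimes>\<^bsub>free_algebra K S\<^esub> word K u = word K (s # u)"
proof
  fix w
  interpret K: field K by fact
  \<comment> \<open>Only the split after the first letter contributes to the convolution.\<close>
  have split: "take i w = [s] \<and> drop i w = u \<longleftrightarrow> i = 1 \<and> w = s # u" if "i \<le> length w" for i
    using that by (cases w; cases i) auto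
  have "(letter K s \<otimes>\<^bsub>free_algebra K S\<^esub> word K u) w =
      (\<Oplus>\<^bsub>K\<^esub>i\<in>{..length w}. letter K s (take i w) \<otimes>\<^bsub>K\<^esub> word K u (drop i w))"
    by (simp add: free_algebra_def)
  also have "\<dots> = (\<Oplus>\<^bsub>K\<^esub>i\<in>{..length w}. if 1 = i then word K (s # u) w else \<zero>\<^bsub>K\<^esub>)"
    using split by (intro K.finsum_cong') (auto simp: letter_def word_def)
  also have "\<dots> = word K (s # u) w"
  proof (cases "w = []")
    case False
    then show ?thesis
      using K.add.finprod_singleton[of 1 "{..length w}" "\<lambda>_. word K (s # u) w"]
      by (auto simp: word_def Suc_le_eq)
  qed (simp add: word_def)
  finally show "(letter K s \<otimes>\<^bsub>free_algebra K S\<^esub> word K u) w = word K (s # u) w" .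
qed

text \<open>Words span the free algebra. The step adds one term \<open>c u\<close> at a time, so a property that is
  additive and homogeneous need only be checked on words.\<close>

lemma free_algebra_induct [consumes 2, case_names zero add]:
  assumes "field K" "p \<in> carrier (free_algebra K S)"
    and zero: "P \<zero>\<^bsub>free_algebra K S\<^esub>"
    and add: "\<And>c u q. \<lbrakk>c \<in> carrier K; u \<in> lists S; q \<in> carrier (free_algebra K S); P q\<rbrakk> \<Longrightarrow>
        P (c \<odot>\<^bsub>free_algebra K S\<^esub> word K u \<oplus>\<^bsub>free_algebra K S\<^esub> q)"
  shows "P p"
proof -
  interpret K: field K by fact
  have "finite T \<Longrightarrow> p \<in> carrier (free_algebra K S) \<Longrightarrow> {w. p w \<noteq> \<zero>\<^bsub>K\<^esub>} = T \<Longrightarrow> P p" for T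
  proof (induction T arbitrary: p rule: finite_induct)
    case empty
    then have "p = \<zero>\<^bsub>free_algebra K S\<^esub>" by (auto simp: free_algebra_def)
    then show ?case using zero by simp
  next
    case (insert u T)
    \<comment> \<open>Split off the term of \<open>p\<close> at the word \<open>u\<close>.\<close>
    let ?q = "p(u := \<zero>\<^bsub>K\<^esub>)"
    have q: "{w. ?q w \<noteq> \<zero>\<^bsub>K\<^esub>} = T" using insert.prems(2) insert.hyps(2) by auto
    have "?q \<in> carrier (free_algebra K S)"
      using insert.prems(1) by (auto simp: free_algebra_def elim: rev_finite_subset)
    moreover have "p u \<in> carrier K" "u \<in> lists S" and pK: "\<And>w. p w \<in> carrier K"
      using insert.prems by (auto simp: free_algebra_def)
    ultimately have "P (p u \<odot>\<^bsub>free_algebra K S\<^esub> word K u \<oplus>\<^bsub>free_algebra K S\<^esub> ?q)"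
      using insert.IH q by (intro add) auto
    moreover have "p u \<odot>\<^bsub>free_algebra K S\<^esub> word K u \<oplus>\<^bsub>free_algebra K S\<^esub> ?q = p"
      using pK by (auto simp: free_algebra_def word_def)
    ultimately show ?case by simp
  qed
  then show ?thesis using assms(2) by (auto simp: free_algebra_def)
qed

text \<open>Two homomorphisms that agree on letters agree on words, which are products of letters, and
  hence on the linear combinations of words.\<close>

lemma free_algebra_hom_unique:
  assumes "field K" "assoc_algebra K A"
    and h: "h \<in> algebra_hom K (free_algebra K S) A"
    and k: "k \<in> algebra_hom K (free_algebra K S) A"
    and letters: "\<And>s. s \<in> S \<Longrightarrow> h (letter K s) = k (letter K s)"
    and "p \<in> carrier (free_algebra K S)"
  shows "h p = k p"
proof -
  interpret F: assoc_algebra K "free_algebra K S" by (rule assoc_algebra_free_algebra) fact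
  interpret h: ring_hom_ring "free_algebra K S" A h
    by (rule algebra_hom_ring_hom_ring) (rule F.assoc_algebra_axioms assms)+
  interpret k: ring_hom_ring "free_algebra K S" A k
    by (rule algebra_hom_ring_hom_ring) (rule F.assoc_algebra_axioms assms)+
  have word: "h (word K u) = k (word K u)" if "u \<in> lists S" for u
    using that
  proof (induction u)
    case Nil
    show ?case using h.hom_one k.hom_one by (simp add: one_eq_word)
  next
    case (Cons s u)
    have "h (letter K s \<otimes>\<^bsub>free_algebra K S\<^esub> word K u) = k (letter K s \<otimes>\<^bsub>free_algebra K S\<^esub> word K u)"
      using Cons assms(1) by (simp add: letter_carrier word_carrier letters)
    then show ?case using assms(1) by (simp add: letter_mult_word)
  qed
  from assms(1,6) show ?thesis
  proof (induction rule: free_algebra_induct)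
    case (add c u q)
    then show ?case
      using word assms(1) by (simp add: word_carrier h[THEN algebra_hom_smult] k[THEN algebra_hom_smult])
  qed simp
qed

definition word_value :: "('k, 'a, 'p) module_scheme \<Rightarrow> ('s \<Rightarrow> 'a) \<Rightarrow> 's list \<Rightarrow> 'a"
  where "word_value A f u = foldr (\<lambda>s a. f s \<otimes>\<^bsub>A\<^esub> a) u \<one>\<^bsub>A\<^esub>"

definition free_eval ::
    "('k, 'm) ring_scheme \<Rightarrow> ('k, 'a, 'p) module_scheme \<Rightarrow> ('s \<Rightarrow> 'a) \<Rightarrow> ('s list \<Rightarrow> 'k) \<Rightarrow> 'a"
  where "free_eval K A f p = (\<Oplus>\<^bsub>A\<^esub>w\<in>{w. p w \<noteq> \<zero>\<^bsub>K\<^esub>}. p w \<odot>\<^bsub>A\<^esub> word_value A f w)"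

context assoc_algebra
begin

lemma word_value_closed: "f \<in> S \<rightarrow> carrier A \<Longrightarrow> u \<in> lists S \<Longrightarrow> word_value A f u \<in> carrier A"
  unfolding word_value_def by (induction u) auto

text \<open>The sum that defines \<open>free_eval\<close> runs over the support of its argument. Allowing a larger
  index set makes it possible to compare the values at \<open>p\<close>, \<open>q\<close> and \<open>p + q\<close>, whose
  supports differ.\<close>

lemma free_eval_superset:
  assumes "f \<in> S \<rightarrow> carrier A" "p \<in> carrier (free_algebra K S)"
    and "finite T" "T \<subseteq> lists S" "{w. p w \<noteq> \<zero>\<^bsub>K\<^esub>} \<subseteq> T"
  shows "free_eval K A f p = (\<Oplus>\<^bsub>A\<^esub>w\<in>T. p w \<odot>\<^bsub>A\<^esub> word_value A f w)"
  unfolding free_eval_def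
proof (rule M.add.finprod_mono_neutral_cong_left)
  have p: "p w \<in> carrier K" for w using assms(2) by (auto simp: free_algebra_def)
  have v: "word_value A f w \<in> carrier A" if "w \<in> T" for w
    using word_value_closed[OF assms(1)] assms(4) that by blast
  show "(\<lambda>w. p w \<odot>\<^bsub>A\<^esub> word_value A f w) \<in> T \<rightarrow> carrier A"
    using p v by auto
  show "p w \<odot>\<^bsub>A\<^esub> word_value A f w = \<zero>\<^bsub>A\<^esub>" if "w \<in> T - {w. p w \<noteq> \<zero>\<^bsub>K\<^esub>}" for w
    using that v by auto
qed (use assms in auto)

lemma free_eval_closed:
  assumes "f \<in> S \<rightarrow> carrier A" "p \<in> carrier (free_algebra K S)"
  shows "free_eval K A f p \<in> carrier A"
  unfolding free_eval_def
proof (rule M.finsum_closed, rule Pi_I)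
  fix w assume "w \<in> {w. p w \<noteq> \<zero>\<^bsub>K\<^esub>}"
  then have "p w \<in> carrier K" "w \<in> lists S" using assms(2) by (auto simp: free_algebra_def)
  then show "p w \<odot>\<^bsub>A\<^esub> word_value A f w \<in> carrier A"
    using word_value_closed[OF assms(1)] by simp
qed

lemma free_eval_add:
  assumes f: "f \<in> S \<rightarrow> carrier A"
    and p: "p \<in> carrier (free_algebra K S)" and q: "q \<in> carrier (free_algebra K S)"
  shows "free_eval K A f (p \<oplus>\<^bsub>free_algebra K S\<^esub> q) = free_eval K A f p \<oplus>\<^bsub>A\<^esub> free_eval K A f q"
proof -
  interpret F: assoc_algebra K "free_algebra K S"
    by (rule assoc_algebra_free_algebra) (rule field_axioms)
  let ?T = "{w. p w \<noteq> \<zero>\<^bsub>K\<^esub>} \<union> {w. q w \<noteq> \<zero>\<^bsub>K\<^esub>}"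
  have T: "finite ?T" "?T \<subseteq> lists S" and c: "p w \<in> carrier K" "q w \<in> carrier K" for w
    using p q by (auto simp: free_algebra_def)
  have sum: "(p \<oplus>\<^bsub>free_algebra K S\<^esub> q) w = p w \<oplus>\<^bsub>K\<^esub> q w" for w by (simp add: free_algebra_def)
  have sub: "{w. p w \<oplus>\<^bsub>K\<^esub> q w \<noteq> \<zero>\<^bsub>K\<^esub>} \<subseteq> ?T" by auto
  have v: "word_value A f w \<in> carrier A" if "w \<in> ?T" for w
    using that T(2) word_value_closed[OF f] by blast
  have "free_eval K A f (p \<oplus>\<^bsub>free_algebra K S\<^esub> q) =
      (\<Oplus>\<^bsub>A\<^esub>w\<in>?T. (p w \<oplus>\<^bsub>K\<^esub> q w) \<odot>\<^bsub>A\<^esub> word_value A f w)"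
    using free_eval_superset[OF f F.a_closed[OF p q] T] sub by (simp only: sum)
  also have "\<dots> = (\<Oplus>\<^bsub>A\<^esub>w\<in>?T. p w \<odot>\<^bsub>A\<^esub> word_value A f w \<oplus>\<^bsub>A\<^esub> q w \<odot>\<^bsub>A\<^esub> word_value A f w)"
    using v c by (intro M.finsum_cong') (auto intro!: smult_l_distr)
  also have "\<dots> = (\<Oplus>\<^bsub>A\<^esub>w\<in>?T. p w \<odot>\<^bsub>A\<^esub> word_value A f w) \<oplus>\<^bsub>A\<^esub> (\<Oplus>\<^bsub>A\<^esub>w\<in>?T. q w \<odot>\<^bsub>A\<^esub> word_value A f w)"
    using v c by (intro M.finsum_addf) auto
  also have "\<dots> = free_eval K A f p \<oplus>\<^bsub>A\<^esub> free_eval K A f q"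
    using free_eval_superset[OF f p T] free_eval_superset[OF f q T] by auto
  finally show ?thesis .
qed

lemma free_eval_smult:
  assumes f: "f \<in> S \<rightarrow> carrier A" and c: "c \<in> carrier K" and p: "p \<in> carrier (free_algebra K S)"
  shows "free_eval K A f (c \<odot>\<^bsub>free_algebra K S\<^esub> p) = c \<odot>\<^bsub>A\<^esub> free_eval K A f p"
proof -
  interpret F: assoc_algebra K "free_algebra K S"
    by (rule assoc_algebra_free_algebra) (rule field_axioms)
  let ?T = "{w. p w \<noteq> \<zero>\<^bsub>K\<^esub>}"
  have T: "finite ?T" "?T \<subseteq> lists S" and pK: "p w \<in> carrier K" for w
    using p by (auto simp: free_algebra_def)
  have prod: "(c \<odot>\<^bsub>free_algebra K S\<^esub> p) w = c \<otimes>\<^bsub>K\<^esub> p w" for w by (simp add: free_algebra_def)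
  have sub: "{w. c \<otimes>\<^bsub>K\<^esub> p w \<noteq> \<zero>\<^bsub>K\<^esub>} \<subseteq> ?T" using c by auto
  have v: "word_value A f w \<in> carrier A" if "w \<in> ?T" for w
    using that T(2) word_value_closed[OF f] by blast
  have "free_eval K A f (c \<odot>\<^bsub>free_algebra K S\<^esub> p) = (\<Oplus>\<^bsub>A\<^esub>w\<in>?T. (c \<otimes>\<^bsub>K\<^esub> p w) \<odot>\<^bsub>A\<^esub> word_value A f w)"
    using free_eval_superset[OF f F.smult_closed[OF c p] T] sub by (simp only: prod)
  also have "\<dots> = (\<Oplus>\<^bsub>A\<^esub>w\<in>?T. c \<odot>\<^bsub>A\<^esub> (p w \<odot>\<^bsub>A\<^esub> word_value A f w))"
    using v c pK by (intro M.finsum_cong') (auto intro!: smult_assoc1)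
  also have "\<dots> = c \<odot>\<^bsub>A\<^esub> free_eval K A f p"
    unfolding free_eval_def using v c pK by (intro finsum_smult_ldistr[symmetric] T) auto
  finally show ?thesis .
qed

lemma free_eval_word:
  assumes "f \<in> S \<rightarrow> carrier A" "u \<in> lists S"
  shows "free_eval K A f (word K u) = word_value A f u"
proof -
  have "{w. word K u w \<noteq> \<zero>\<^bsub>K\<^esub>} = {u}" by (auto simp: word_def)
  then show ?thesis
    using word_value_closed[OF assms] by (simp add: free_eval_def) (simp add: word_def)
qed

text \<open>Multiplicativity is reduced to concatenation of words without comparing double sums: it is
  proved for a letter times \<open>q\<close> by linearity in \<open>q\<close>, then for a word times \<open>q\<close> by associativity
  and induction on the word, and then in general by linearity in the first factor.\<close>

lemma free_eval_hom:
  assumes f: "f \<in> S \<rightarrow> carrier A"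
  shows "free_eval K A f \<in> algebra_hom K (free_algebra K S) A"
proof -
  let ?F = "free_algebra K S" and ?e = "free_eval K A f"
  have K: "field K" by (rule field_axioms)
  interpret F: assoc_algebra K ?F by (rule assoc_algebra_free_algebra) (rule K)
  note simps = free_eval_add[OF f] free_eval_smult[OF f] free_eval_word[OF f] free_eval_closed[OF f]
    word_value_closed[OF f] word_carrier[OF K] letter_carrier[OF K]
  have e_zero: "?e \<zero>\<^bsub>?F\<^esub> = \<zero>\<^bsub>A\<^esub>"
    by (simp add: free_eval_def free_algebra_def)
  have letter: "?e (letter K s \<otimes>\<^bsub>?F\<^esub> q) = f s \<otimes>\<^bsub>A\<^esub> ?e q" if s: "s \<in> S" and q: "q \<in> carrier ?F" for s q
    using K q
  proof (induction rule: free_algebra_induct)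
    case zero
    then show ?case using s f by (auto simp: simps e_zero Pi_iff)
  next
    case (add c u q)
    have fs: "f s \<in> carrier A" using f s by auto
    have "letter K s \<otimes>\<^bsub>?F\<^esub> (c \<odot>\<^bsub>?F\<^esub> word K u \<oplus>\<^bsub>?F\<^esub> q) =
        c \<odot>\<^bsub>?F\<^esub> word K (s # u) \<oplus>\<^bsub>?F\<^esub> letter K s \<otimes>\<^bsub>?F\<^esub> q"
      using add s by (simp add: F.A.r_distr F.smult_mult_right simps letter_mult_word[OF K])
    moreover have "word_value A f (s # u) = f s \<otimes>\<^bsub>A\<^esub> word_value A f u"
      by (simp add: word_value_def)
    ultimately show ?case
      using add s fs by (simp add: simps A.r_distr smult_mult_right)
  qed
  have word: "?e (word K u \<otimes>\<^bsub>?F\<^esub> q) = word_value A f u \<otimes>\<^bsub>A\<^esub> ?e q"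
    if "u \<in> lists S" and q: "q \<in> carrier ?F" for u q
    using that(1)
  proof (induction u)
    case Nil
    show ?case using q by (simp add: one_eq_word[of K S, symmetric] word_value_def simps)
  next
    case (Cons s u)
    have fs: "f s \<in> carrier A" using f Cons by auto
    have "word K (s # u) \<otimes>\<^bsub>?F\<^esub> q = letter K s \<otimes>\<^bsub>?F\<^esub> (word K u \<otimes>\<^bsub>?F\<^esub> q)"
      using Cons q by (simp add: F.A.m_assoc[symmetric] simps letter_mult_word[OF K])
    then show ?case using Cons q fs by (simp add: simps letter word_value_def[of A f "s # u"] A.m_assoc flip: word_value_def)
  qed
  show ?thesis
  proof (rule algebra_homI)
    fix p q assume "p \<in> carrier ?F" and q: "q \<in> carrier ?F"
    from K this(1) show "?e (p \<otimes>\<^bsub>?F\<^esub> q) = ?e p \<otimes>\<^bsub>A\<^esub> ?e q"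
    proof (induction rule: free_algebra_induct)
      case zero
      then show ?case using q by (simp add: simps e_zero)
    next
      case (add c u p)
      then show ?case
        using q by (simp add: F.A.l_distr F.smult_mult_left simps word A.l_distr smult_mult_left)
    qed
  qed (simp_all add: simps one_eq_word, simp add: word_value_def)
qed

lemma free_eval_letter: "f \<in> S \<rightarrow> carrier A \<Longrightarrow> s \<in> S \<Longrightarrow> free_eval K A f (letter K s) = f s"
  using free_eval_word[of f S "[s]"] by (auto simp: letter_eq_word word_value_def Pi_iff)

end

section \<open>The tensor algebra\<close>

text \<open>The evaluation of the free algebra at \<open>f\<close> sends \<open>[u + v] - ([u] + [v])\<close> to
  \<open>f (u + v) - (f u + f v)\<close> and \<open>[c v] - c [v]\<close> to \<open>f (c v) - c f v\<close>; both vanish because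
  \<open>f\<close> is linear.\<close>

lemma tensor_algebra_lift:
  assumes "vectorspace K V" "assoc_algebra K A" and f: "f \<in> module_hom K V A"
  shows "\<exists>h\<in>algebra_hom K (tensor_algebra K V) A. \<forall>v\<in>carrier V. h (tensor_incl K V v) = f v"
proof -
  let ?F = "free_algebra K (carrier V)" and ?e = "free_eval K A f"
  interpret V: vectorspace K V by fact
  interpret A: assoc_algebra K A by fact
  have K: "field K" by (rule V.field_axioms)
  have F: "assoc_algebra K ?F" using K by (rule assoc_algebra_free_algebra)
  interpret F: assoc_algebra K ?F by (rule F)
  have fA: "f \<in> carrier V \<rightarrow> carrier A" using f by (rule module_hom_closed)
  have e: "?e \<in> algebra_hom K ?F A" using fA by (rule A.free_eval_hom)
  note simps = e[THEN algebra_hom_add] e[THEN algebra_hom_smult] algebra_hom_minus[OF F assms(2) e]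
    letter_carrier[OF K] A.free_eval_letter[OF fA] module_hom_add[OF f] module_hom_smult[OF f]
  have R: "tensor_relations K V \<subseteq> carrier ?F"
    unfolding tensor_relations_def Let_def
    by (auto intro!: F.minus_closed F.a_closed F.smult_closed letter_carrier K)
  have "?e r = \<zero>\<^bsub>A\<^esub>" if "r \<in> tensor_relations K V" for r
    using that fA unfolding tensor_relations_def Let_def
    by (auto simp: simps A.minus_eq A.r_neg Pi_iff)
  from quot_genideal_lift[OF F assms(2) e R this] obtain h
    where "h \<in> algebra_hom K (tensor_algebra K V) A"
      and "\<And>p. p \<in> carrier ?F \<Longrightarrow> h (tensor_ideal K V +>\<^bsub>?F\<^esub> p) = ?e p"
    unfolding tensor_algebra_def tensor_ideal_def by blast
  then show ?thesis unfolding tensor_incl_def by (intro bexI[of _ h]) (simp_all add: simps)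
qed

text \<open>Pulled back along the projection from the free algebra, two homomorphisms that agree on
  \<open>V\<close> agree on letters.\<close>

lemma tensor_algebra_hom_unique:
  assumes "vectorspace K V" "assoc_algebra K A"
    and h: "h \<in> algebra_hom K (tensor_algebra K V) A"
    and k: "k \<in> algebra_hom K (tensor_algebra K V) A"
    and eq: "\<And>v. v \<in> carrier V \<Longrightarrow> h (tensor_incl K V v) = k (tensor_incl K V v)"
    and t: "t \<in> carrier (tensor_algebra K V)"
  shows "h t = k t"
proof -
  let ?F = "free_algebra K (carrier V)" and ?\<pi> = "\<lambda>p. tensor_ideal K V +>\<^bsub>free_algebra K (carrier V)\<^esub> p"
  have K: "field K" using assms(1) by (simp add: vectorspace_def)
  have \<pi>: "?\<pi> \<in> algebra_hom K ?F (tensor_algebra K V)"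
    unfolding tensor_algebra_def
    using assoc_algebra_free_algebra[OF K] ideal_tensor_ideal[OF assms(1)] by (rule quot_projection_hom)
  from t obtain p where p: "p \<in> carrier ?F" "t = ?\<pi> p"
    unfolding tensor_algebra_def carrier_quot_algebra by blast
  have "h (?\<pi> p) = k (?\<pi> p)"
    using K assms(2) algebra_hom_comp[OF \<pi> h] algebra_hom_comp[OF \<pi> k] eq[unfolded tensor_incl_def] p(1)
    by (rule free_algebra_hom_unique)
  then show ?thesis using p(2) by simp
qed

section \<open>The skew Clifford algebra\<close>

text \<open>The defining relation as an expression in an arbitrary algebra \<open>A\<close> with chosen elements
  \<open>y i\<close>. One expression then covers the generators of the skew Clifford ideal in \<open>T(V)\<close> and
  their images under homomorphisms. The scalars \<open>b i j\<close> stand for \<open>2 \<phi> (x i) (x j)\<close>.\<close>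

definition skew_relation ::
    "(nat \<Rightarrow> nat \<Rightarrow> 'k) \<Rightarrow> (nat \<Rightarrow> nat \<Rightarrow> 'k) \<Rightarrow>
     ('k, 'a, 'p) module_scheme \<Rightarrow> (nat \<Rightarrow> 'a) \<Rightarrow> nat \<Rightarrow> nat \<Rightarrow> 'a"
  where "skew_relation \<mu> b A y i j =
    y i \<otimes>\<^bsub>A\<^esub> y j \<oplus>\<^bsub>A\<^esub> \<mu> i j \<odot>\<^bsub>A\<^esub> (y j \<otimes>\<^bsub>A\<^esub> y i) \<ominus>\<^bsub>A\<^esub> b i j \<odot>\<^bsub>A\<^esub> \<one>\<^bsub>A\<^esub>"

lemma skew_relation_closed:
  assumes "assoc_algebra K A" "y i \<in> carrier A" "y j \<in> carrier A"
    and "\<mu> i j \<in> carrier K" "b i j \<in> carrier K"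
  shows "skew_relation \<mu> b A y i j \<in> carrier A"
proof -
  interpret A: assoc_algebra K A by fact
  show ?thesis unfolding skew_relation_def using assms
    by (intro A.minus_closed A.a_closed A.A.m_closed A.smult_closed A.A.one_closed)
qed

lemma skew_relation_hom:
  assumes A: "assoc_algebra K A" and B: "assoc_algebra K B" and h: "h \<in> algebra_hom K A B"
    and "y i \<in> carrier A" "y j \<in> carrier A"
    and "\<mu> i j \<in> carrier K" "b i j \<in> carrier K"
  shows "h (skew_relation \<mu> b A y i j) = skew_relation \<mu> b B (\<lambda>i. h (y i)) i j"
proof -
  interpret A: assoc_algebra K A by fact
  show ?thesis
    using assms(4-)
    by (simp add: skew_relation_def algebra_hom_minus[OF A B h] h[THEN algebra_hom_add]
      h[THEN algebra_hom_mult] h[THEN algebra_hom_smult] h[THEN algebra_hom_one])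
qed

lemma skew_relation_eq_zero_iff:
  assumes "assoc_algebra K A" "y i \<in> carrier A" "y j \<in> carrier A"
    and "\<mu> i j \<in> carrier K" "b i j \<in> carrier K"
  shows "skew_relation \<mu> b A y i j = \<zero>\<^bsub>A\<^esub> \<longleftrightarrow>
    y i \<otimes>\<^bsub>A\<^esub> y j \<oplus>\<^bsub>A\<^esub> \<mu> i j \<odot>\<^bsub>A\<^esub> (y j \<otimes>\<^bsub>A\<^esub> y i) = b i j \<odot>\<^bsub>A\<^esub> \<one>\<^bsub>A\<^esub>"
proof -
  interpret A: assoc_algebra K A by fact
  have "a \<ominus>\<^bsub>A\<^esub> c = \<zero>\<^bsub>A\<^esub> \<longleftrightarrow> a = c" if "a \<in> carrier A" "c \<in> carrier A" for a c
    using that A.minus_equality[of a "\<ominus>\<^bsub>A\<^esub> c"] by (auto simp: a_minus_def A.r_neg)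
  then show ?thesis unfolding skew_relation_def using assms by simp
qed

theorem theorem2p6:
  fixes K :: "('k, 'm) ring_scheme"
    and V :: "('k, 'v, 'p) module_scheme"
    and n :: nat
    and x :: "nat \<Rightarrow> 'v"
    and \<mu> :: "nat \<Rightarrow> nat \<Rightarrow> 'k"
    and \<phi> :: "'v \<Rightarrow> 'v \<Rightarrow> 'k"
  defines "S \<equiv> skew_clifford K V n x \<mu> \<phi>"
    and "g \<equiv> skew_clifford_incl K V n x \<mu> \<phi>"
  assumes "field K" and "ring_characteristic K \<noteq> 2"
    and "vectorspace K V"
    and "ordered_basis K V n x"
    and "mult_antisymmetric K n \<mu>"
    and "bilinear_form K V \<phi>"
    and "mu_symmetric K n x \<mu> \<phi>"
    and "inj_on g (carrier V)"
  shows "(\<forall>i\<in>{1..n}. \<forall>j\<in>{1..n}.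
            g (x i) \<otimes>\<^bsub>S\<^esub> g (x j) \<oplus>\<^bsub>S\<^esub> \<mu> i j \<odot>\<^bsub>S\<^esub> (g (x j) \<otimes>\<^bsub>S\<^esub> g (x i)) =
            ([(2::nat)] \<cdot>\<^bsub>K\<^esub> \<phi> (x i) (x j)) \<odot>\<^bsub>S\<^esub> \<one>\<^bsub>S\<^esub>) \<and>
         (\<forall>(A :: ('k, 'a, 'q) module_scheme) f.
            assoc_algebra K A \<longrightarrow> f \<in> module_hom K V A \<longrightarrow> inj_on f (carrier V) \<longrightarrow>
            (\<forall>i\<in>{1..n}. \<forall>j\<in>{1..n}.
               f (x i) \<otimes>\<^bsub>A\<^esub> f (x j) \<oplus>\<^bsub>A\<^esub> \<mu> i j \<odot>\<^bsub>A\<^esub> (f (x j) \<otimes>\<^bsub>A\<^esub> f (x i)) =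
               ([(2::nat)] \<cdot>\<^bsub>K\<^esub> \<phi> (x i) (x j)) \<odot>\<^bsub>A\<^esub> \<one>\<^bsub>A\<^esub>) \<longrightarrow>
            (\<exists>!h. h \<in> algebra_hom K S A \<and> h \<in> extensional (carrier S) \<and>
                  (\<forall>v\<in>carrier V. f v = h (g v))))"
proof -
  let ?T = "tensor_algebra K V" and ?\<iota> = "tensor_incl K V" and ?I = "skew_clifford_ideal K V n x \<mu> \<phi>"
  define b where "b i j = [(2::nat)] \<cdot>\<^bsub>K\<^esub> \<phi> (x i) (x j)" for i j
  define R where "R = {skew_relation \<mu> b ?T (\<lambda>i. ?\<iota> (x i)) i j | i j. i \<in> {1..n} \<and> j \<in> {1..n}}"
  have I: "?I = Idl\<^bsub>?T\<^esub> R"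
    by (simp add: skew_clifford_ideal_def R_def skew_relation_def b_def Let_def)
  interpret V: vectorspace K V by fact
  have T: "assoc_algebra K ?T" by (rule assoc_algebra_tensor_algebra) fact
  interpret T: assoc_algebra K ?T by (rule T)
  have S: "assoc_algebra K S" unfolding S_def by (rule assoc_algebra_skew_clifford) fact+
  have idl: "ideal ?I ?T" by (rule ideal_skew_clifford_ideal) fact+
  define \<pi> where "\<pi> t = ?I +>\<^bsub>?T\<^esub> t" for t
  have \<pi>: "\<pi> \<in> algebra_hom K ?T S"
    unfolding S_def skew_clifford_def \<pi>_def using T idl by (rule quot_projection_hom)
  have carrier_S: "carrier S = \<pi> ` carrier ?T"
    unfolding S_def skew_clifford_def carrier_quot_algebra \<pi>_def ..
  have g: "g v = \<pi> (?\<iota> v)" for v by (simp add: g_def skew_clifford_incl_def \<pi>_def)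
  have x: "x i \<in> carrier V" if "i \<in> {1..n}" for i
    using \<open>ordered_basis K V n x\<close> that unfolding ordered_basis_def V.basis_def by blast
  have \<iota>: "?\<iota> v \<in> carrier ?T" if "v \<in> carrier V" for v
    using \<open>vectorspace K V\<close> that by (rule tensor_incl_carrier)
  have \<mu>: "\<mu> i j \<in> carrier K" if "i \<in> {1..n}" "j \<in> {1..n}" for i j
    using \<open>mult_antisymmetric K n \<mu>\<close> that unfolding mult_antisymmetric_def by blast
  have b: "b i j \<in> carrier K" if "i \<in> {1..n}" "j \<in> {1..n}" for i j
    using \<open>bilinear_form K V \<phi>\<close> x that unfolding bilinear_form_def b_def
    by (intro V.add_nat_pow_closed) blast
  have R: "R \<subseteq> carrier ?T"
    unfolding R_def by (auto intro!: skew_relation_closed T \<iota> x \<mu> b simp del: atLeastAtMost_iff)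

  have "g (x i) \<otimes>\<^bsub>S\<^esub> g (x j) \<oplus>\<^bsub>S\<^esub> \<mu> i j \<odot>\<^bsub>S\<^esub> (g (x j) \<otimes>\<^bsub>S\<^esub> g (x i)) = b i j \<odot>\<^bsub>S\<^esub> \<one>\<^bsub>S\<^esub>"
    if ij: "i \<in> {1..n}" "j \<in> {1..n}" for i j
  proof -
    let ?r = "skew_relation \<mu> b ?T (\<lambda>i. ?\<iota> (x i)) i j"
    have "?r \<in> ?I" unfolding I using T.genideal_self[OF R] ij by (auto simp: R_def)
    then have "\<pi> ?r = ?I" unfolding \<pi>_def
      by (simp add: T.A.a_rcos_zero[OF idl])
    also have "?I = \<zero>\<^bsub>S\<^esub>" by (simp add: S_def skew_clifford_def quot_algebra_def FactRing_def)
    finally have "skew_relation \<mu> b S (\<lambda>i. g (x i)) i j = \<zero>\<^bsub>S\<^esub>"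
      unfolding g using ij by (simp only: skew_relation_hom[OF T S \<pi>] \<iota> x \<mu> b)
    moreover have "g (x i) \<in> carrier S" "g (x j) \<in> carrier S"
      unfolding g using ij by (simp_all only: \<pi>[THEN algebra_hom_closed] \<iota> x)
    ultimately show ?thesis
      using skew_relation_eq_zero_iff[OF S, of "\<lambda>i. g (x i)" i j \<mu> b] \<mu> b ij by simp
  qed
  moreover have "\<exists>!h. h \<in> algebra_hom K S A \<and> h \<in> extensional (carrier S) \<and> (\<forall>v\<in>carrier V. f v = h (g v))"
    if A: "assoc_algebra K A" and f: "f \<in> module_hom K V A"
      and rel: "\<forall>i\<in>{1..n}. \<forall>j\<in>{1..n}.
        f (x i) \<otimes>\<^bsub>A\<^esub> f (x j) \<oplus>\<^bsub>A\<^esub> \<mu> i j \<odot>\<^bsub>A\<^esub> (f (x j) \<otimes>\<^bsub>A\<^esub> f (x i)) = b i j \<odot>\<^bsub>A\<^esub> \<one>\<^bsub>A\<^esub>"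
    for A :: "('k, 'a, 'q) module_scheme" and f
  proof (rule ex_ex1I)
    obtain h where h: "h \<in> algebra_hom K ?T A" and hf: "\<And>v. v \<in> carrier V \<Longrightarrow> h (?\<iota> v) = f v"
      using tensor_algebra_lift[OF \<open>vectorspace K V\<close> A f] by blast
    have fA: "f v \<in> carrier A" if "v \<in> carrier V" for v
      using module_hom_closed[OF f] that by blast
    have "h r = \<zero>\<^bsub>A\<^esub>" if "r \<in> R" for r
    proof -
      from that obtain i j where ij: "i \<in> {1..n}" "j \<in> {1..n}"
        and r: "r = skew_relation \<mu> b ?T (\<lambda>i. ?\<iota> (x i)) i j"
        unfolding R_def by blast
      have "h r = skew_relation \<mu> b A (\<lambda>i. h (?\<iota> (x i))) i j"
        unfolding r using ij by (simp only: skew_relation_hom[OF T A h] \<iota> x \<mu> b)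
      also have "\<dots> = \<zero>\<^bsub>A\<^esub>"
        using skew_relation_eq_zero_iff[OF A, of "\<lambda>i. h (?\<iota> (x i))" i j \<mu> b] rel ij
        by (simp only: hf fA x \<mu> b)
      finally show ?thesis .
    qed
    from quot_genideal_lift[OF T A h R this] obtain k
      where k: "k \<in> algebra_hom K S A" and kh: "\<And>t. t \<in> carrier ?T \<Longrightarrow> k (\<pi> t) = h t"
      unfolding S_def skew_clifford_def \<pi>_def I by blast
    \<comment> \<open>Uniqueness can hold only for functions with a prescribed value outside the carrier, so \<open>k\<close>
      is made undefined there.\<close>
    have "restrict k (carrier S) (g v) = f v" if "v \<in> carrier V" for v
      using that by (simp add: g \<iota> kh hf \<pi>[THEN algebra_hom_closed])
    then show "\<exists>h. h \<in> algebra_hom K S A \<and> h \<in> extensional (carrier S) \<and> (\<forall>v\<in>carrier V. f v = h (g v))"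
      using algebra_hom_restrict[OF S k] by (intro exI[of _ "restrict k (carrier S)"]) auto
  next
    fix h k
    assume h: "h \<in> algebra_hom K S A \<and> h \<in> extensional (carrier S) \<and> (\<forall>v\<in>carrier V. f v = h (g v))"
      and k: "k \<in> algebra_hom K S A \<and> k \<in> extensional (carrier S) \<and> (\<forall>v\<in>carrier V. f v = k (g v))"
    have "h (\<pi> t) = k (\<pi> t)" if "t \<in> carrier ?T" for t
    proof (rule tensor_algebra_hom_unique[OF \<open>vectorspace K V\<close> A _ _ _ that])
      show "(\<lambda>t. h (\<pi> t)) \<in> algebra_hom K ?T A" using \<pi> h by (blast intro: algebra_hom_comp)
      show "(\<lambda>t. k (\<pi> t)) \<in> algebra_hom K ?T A" using \<pi> k by (blast intro: algebra_hom_comp)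
    qed (use h k in \<open>simp flip: g\<close>)
    then show "h = k"
      using h k by (intro extensionalityI[of h "carrier S"]) (auto simp: carrier_S)
  qed
  ultimately show ?thesis unfolding b_def by blast
qed

end
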